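(* Let $A,E\in\mathbb{R}^{n\times n}$ with $\det E\neq 0$, let $B\in\mathbb{R}^{n\times m}$, and assume that all eigenvalues of $E^{-1}A$ lie in the open left half of the complex plane. Let $(\sigma_1,\dots,\sigma_k)$ be a sequence of complex shifts with $\mathrm{Re}(\sigma_i)>0$ that is closed under complex conjugation, in the sense that each non-real shift occurs in the sequence as often as its complex conjugate. Put $\alpha_i:=\sqrt{2\,\mathrm{Re}(\sigma_i)}$, let $I$ denote the $m\times m$ identity matrix, and let $Z=[Z_1,\dots,Z_k]\in\mathbb{C}^{n\times km}$ be the ADI basis for $(\sigma_1,\dots,\sigma_k)$. Then the residual $$R:=A\widehat PE^T+E\widehat PA^T+BB^T$$ for the approximation $\widehat P=ZZ^*$ is given by $$R=B_\bot B_\bot^T,\qquad\text{where } B_\bot=B+EZL_{\mathrm{ADI}}^T,\quad L_{\mathrm{ADI}}:=[\alpha_1I,\dots,\alpha_kI].$$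
   Context: ${}^*$ denotes conjugate transpose and ${}^T$ plain transpose. The ADI basis for a sequence of shifts $(\sigma_1,\dots,\sigma_k)$ in the open right half plane is $Z=[Z_1,\dots,Z_k]\in\mathbb{C}^{n\times km}$, with blocks $Z_i\in\mathbb{C}^{n\times m}$ defined by $$Z_1=\sqrt{2\,\mathrm{Re}(\sigma_1)}\,(A-\sigma_1E)^{-1}B,$$ $$Z_i=\sqrt{\frac{\mathrm{Re}(\sigma_i)}{\mathrm{Re}(\sigma_{i-1})}}\left(I_n+(\sigma_i+\overline{\sigma_{i-1}})(A-\sigma_iE)^{-1}E\right)Z_{i-1},\qquad i=2,\dots,k,$$ where $I_n$ is the $n\times n$ identity matrix. *)

theory Defs
  imports "Jordan_Normal_Form.Schur_Decomposition" "Jordan_Normal_Form.Gauss_Jordan_Elimination"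
begin

(* No meaningful value when M is not invertible. *)
definition mat_inv :: "'a :: field mat \<Rightarrow> 'a mat" where
  "mat_inv M = the (mat_inverse M)"

abbreviation cmat :: "real mat \<Rightarrow> complex mat" where
  "cmat \<equiv> map_mat complex_of_real"

(* The block row [M_1, ..., M_k]; the number n of rows is explicit so that k = 0 makes sense. *)
definition hcat :: "nat \<Rightarrow> 'a mat list \<Rightarrow> 'a mat" where
  "hcat n Ms = mat_of_cols n (concat (map cols Ms))"

(* Shifts and blocks are indexed from 0: adi_block A E B \<sigma> i is Z_{i+1}, and \<sigma> ! i is \<sigma>_{i+1}. *)
primrec adi_block ::
  "complex mat \<Rightarrow> complex mat \<Rightarrow> complex mat \<Rightarrow> complex list \<Rightarrow> nat \<Rightarrow> complex mat" where
  "adi_block A E B \<sigma> 0 =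
     complex_of_real (sqrt (2 * Re (\<sigma> ! 0))) \<cdot>\<^sub>m (mat_inv (A - (\<sigma> ! 0) \<cdot>\<^sub>m E) * B)"
| "adi_block A E B \<sigma> (Suc i) =
     complex_of_real (sqrt (Re (\<sigma> ! Suc i) / Re (\<sigma> ! i))) \<cdot>\<^sub>m
       ((1\<^sub>m (dim_row A)
          + (\<sigma> ! Suc i + cnj (\<sigma> ! i)) \<cdot>\<^sub>m (mat_inv (A - (\<sigma> ! Suc i) \<cdot>\<^sub>m E) * E))
        * adi_block A E B \<sigma> i)"

definition adi_basis ::
  "complex mat \<Rightarrow> complex mat \<Rightarrow> complex mat \<Rightarrow> complex list \<Rightarrow> complex mat" where
  "adi_basis A E B \<sigma> = hcat (dim_row A) (map (adi_block A E B \<sigma>) [0..<length \<sigma>])"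

definition L_ADI :: "nat \<Rightarrow> complex list \<Rightarrow> complex mat" where
  "L_ADI m \<sigma> = hcat m (map (\<lambda>s. complex_of_real (sqrt (2 * Re s)) \<cdot>\<^sub>m 1\<^sub>m m) \<sigma>)"

definition closed_under_cnj :: "complex list \<Rightarrow> bool" where
  "closed_under_cnj \<sigma> \<longleftrightarrow> (\<forall>s \<in> set \<sigma>. s \<notin> \<real> \<longrightarrow> count_list \<sigma> s = count_list \<sigma> (cnj s))"

end

theory Submission
  imports Defs
begin

text \<open>
  The residual can be factored after every shift. Put $W_0 = B$ and
  $W_i = (A + cnj(\<sigma>_i) E) (A - \<sigma>_i E)^{-1} W_{i-1} = W_{i-1} + 2 Re(\<sigma>_i) E (A - \<sigma>_i E)^{-1} W_{i-1}$.
  The resolvent identity shows that the blocks of the ADI basis are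
  $Z_i = \<alpha>_i (A - \<sigma>_i E)^{-1} W_{i-1}$ (lemma \<open>adi_block_eq\<close>). Since $\<alpha>_i^2 = 2 Re(\<sigma>_i)$, this gives
  $W_i = W_{i-1} + \<alpha>_i E Z_i$, so that $W_k = B_\<bottom>$, and
  $A Z_i = \<sigma>_i E Z_i + \<alpha>_i W_{i-1}$. From these two relations,
  \[ W_i W_i^* = W_{i-1} W_{i-1}^* + A Z_i Z_i^* E^* + E Z_i Z_i^* A^*, \]
  and summing over $i$ yields $R = B_\<bottom> B_\<bottom>^*$ (lemma \<open>residual_eq\<close>).

  It remains to see that $B_\<bottom>$ is real, so that its adjoint is its transpose. The maps
  $W_{i-1} \<mapsto> W_i$ for different shifts commute, so $B_\<bottom>$ depends only on the multiset of shifts.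
  As $A$, $E$ and $B$ are real, conjugating $B_\<bottom>$ amounts to conjugating all shifts, which
  leaves that multiset unchanged (lemma \<open>resid_factor_real\<close>).

  The inverses exist because a singular $A - \<sigma>_i E$ would make $\<sigma>_i$, which lies in the right half
  plane, an eigenvalue of $E^{-1} A$.
\<close>

section \<open>Inverse, conjugate and adjoint\<close>

lemma mat_inv_eqs:
  fixes F :: "'a :: field mat"
  assumes F: "F \<in> carrier_mat n n" and det: "det F \<noteq> 0"
  shows "mat_inv F \<in> carrier_mat n n" "F * mat_inv F = 1\<^sub>m n" "mat_inv F * F = 1\<^sub>m n"
proof -
  have "mat_inverse F \<noteq> None"
    using mat_inverse(1)[OF F] det_non_zero_imp_unit[OF F det] by metis
  then obtain G where "mat_inverse F = Some G"
    by blast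
  then show "mat_inv F \<in> carrier_mat n n" "F * mat_inv F = 1\<^sub>m n" "mat_inv F * F = 1\<^sub>m n"
    using mat_inverse(2)[OF F] by (simp_all add: mat_inv_def)
qed

lemma mat_inv_unique:
  fixes F :: "'a :: field mat"
  assumes F: "F \<in> carrier_mat n n" and G: "G \<in> carrier_mat n n" and FG: "F * G = 1\<^sub>m n"
  shows "mat_inv F = G"
proof -
  have "det F * det G = 1"
    using det_mult[OF F G] FG by simp
  then have det: "det F \<noteq> 0"
    by auto
  note inv = mat_inv_eqs[OF F det]
  have "mat_inv F = mat_inv F * (F * G)"
    using inv(1) FG by simp
  also have "\<dots> = (mat_inv F * F) * G"
    using assoc_mult_mat[OF inv(1) F G] by simp
  also have "\<dots> = G"
    using inv(3) G by simp
  finally show ?thesis .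
qed

abbreviation conj_mat :: "complex mat \<Rightarrow> complex mat" where
  "conj_mat \<equiv> map_mat cnj"

lemma conj_mat_mult:
  assumes "M \<in> carrier_mat n k" and "N \<in> carrier_mat k m"
  shows "conj_mat (M * N) = conj_mat M * conj_mat N"
  using assms by (intro eq_matI) (auto simp: scalar_prod_def)

lemma mat_adjoint_eq: "mat_adjoint M = (conj_mat M)\<^sup>T"
  by (intro eq_matI) (auto simp: mat_adjoint_def mat_of_rows_def)

lemma conj_mat_real: "conj_mat (cmat M) = cmat M"
  by (intro eq_matI) auto

lemma mult_adjoint_index:
  assumes "M \<in> carrier_mat n m" "N \<in> carrier_mat n m" "i < n" "j < n"
  shows "(M * mat_adjoint N) $$ (i, j) = (\<Sum>k<m. M $$ (i, k) * cnj (N $$ (j, k)))"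
  using assms by (auto simp: mat_adjoint_eq scalar_prod_def lessThan_atLeast0)

lemma mat_adjoint_carrier:
  fixes M :: "complex mat"
  shows "M \<in> carrier_mat n m \<Longrightarrow> mat_adjoint M \<in> carrier_mat m n"
  by (auto simp: mat_adjoint_eq)

lemma mat_adjoint_mult:
  fixes M N :: "complex mat"
  assumes M: "M \<in> carrier_mat n k" and N: "N \<in> carrier_mat k m"
  shows "mat_adjoint (M * N) = mat_adjoint N * mat_adjoint M"
proof -
  have "conj_mat M \<in> carrier_mat n k" "conj_mat N \<in> carrier_mat k m"
    using M N by auto
  then show ?thesis
    unfolding mat_adjoint_eq conj_mat_mult[OF M N] by (rule transpose_mult)
qed

lemma sandwich_gram:
  fixes M N Z :: "complex mat"
  assumes M: "M \<in> carrier_mat n n" and N: "N \<in> carrier_mat n n" and Z: "Z \<in> carrier_mat n m"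
  shows "M * (Z * mat_adjoint Z) * mat_adjoint N = (M * Z) * mat_adjoint (N * Z)"
  unfolding mat_adjoint_mult[OF N Z]
  using assoc_mult_mat[OF M Z mat_adjoint_carrier[OF Z]]
    assoc_mult_mat[OF mult_carrier_mat[OF M Z] mat_adjoint_carrier[OF Z] mat_adjoint_carrier[OF N]]
  by simp

lemma mat_inv_conj_mat:
  assumes F: "F \<in> carrier_mat n n" and det: "det F \<noteq> 0"
  shows "mat_inv (conj_mat F) = conj_mat (mat_inv F)"
proof (rule mat_inv_unique)
  note inv = mat_inv_eqs[OF F det]
  show "conj_mat F * conj_mat (mat_inv F) = 1\<^sub>m n"
    unfolding conj_mat_mult[OF F inv(1), symmetric] inv(2) by (intro eq_matI) auto
qed (use F mat_inv_eqs[OF F det] in auto)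

text \<open>
  The algebraic core of the residual formula, used with $X = A Z_i$, $Y = E Z_i$ and $a = \<alpha>_i$.
  Expanding the left-hand side gives $W W^* + a W Y^* + a Y W^* + a^2 Y Y^*$. As
  $a^2 = s + cnj(s)$, the last three terms regroup into
  $(s Y + a W) Y^* + Y (s Y + a W)^*$. This is checked entry by entry.
\<close>

lemma gram_update:
  assumes X: "X \<in> carrier_mat n m" and Y: "Y \<in> carrier_mat n m" and W: "W \<in> carrier_mat n m"
    and X_eq: "X = s \<cdot>\<^sub>m Y + complex_of_real a \<cdot>\<^sub>m W" and a: "a * a = 2 * Re s"
  shows "(W + complex_of_real a \<cdot>\<^sub>m Y) * mat_adjoint (W + complex_of_real a \<cdot>\<^sub>m Y)
    = W * mat_adjoint W + (X * mat_adjoint Y + Y * mat_adjoint X)" (is "?L = ?R")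
proof (rule eq_matI)
  fix i j assume "i < dim_row ?R" and "j < dim_col ?R"
  then have ij: "i < n" "j < n"
    using X Y W by (auto simp: mat_adjoint_eq)
  have V: "W + complex_of_real a \<cdot>\<^sub>m Y \<in> carrier_mat n m"
    using Y W by simp
  have aa: "complex_of_real a * complex_of_real a = s + cnj s"
    using a by (simp add: complex_add_cnj flip: of_real_mult)
  have entry: "(w + complex_of_real a * y) * cnj (w' + complex_of_real a * y')
      = w * cnj w' + ((s * y + complex_of_real a * w) * cnj y' + y * cnj (s * y' + complex_of_real a * w'))"
    for w y w' y'
  proof -
    have "(w + complex_of_real a * y) * cnj (w' + complex_of_real a * y')
      = w * cnj w' + complex_of_real a * w * cnj y' + complex_of_real a * y * cnj w'
        + (complex_of_real a * complex_of_real a) * (y * cnj y')"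
      by (simp add: algebra_simps)
    then show ?thesis
      unfolding aa by (simp add: algebra_simps)
  qed
  have "?L $$ (i, j) = (\<Sum>k<m. (W $$ (i, k) + complex_of_real a * Y $$ (i, k))
      * cnj (W $$ (j, k) + complex_of_real a * Y $$ (j, k)))"
    unfolding mult_adjoint_index[OF V V ij] using ij W Y by (intro sum.cong) auto
  also have "\<dots> = (\<Sum>k<m. W $$ (i, k) * cnj (W $$ (j, k))
      + (X $$ (i, k) * cnj (Y $$ (j, k)) + Y $$ (i, k) * cnj (X $$ (j, k))))"
    unfolding entry X_eq using ij W Y by (intro sum.cong) auto
  also have "\<dots> = (W * mat_adjoint W) $$ (i, j) + ((X * mat_adjoint Y) $$ (i, j) + (Y * mat_adjoint X) $$ (i, j))"
    unfolding sum.distrib mult_adjoint_index[OF W W ij] mult_adjoint_index[OF X Y ij]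
      mult_adjoint_index[OF Y X ij] ..
  also have "\<dots> = ?R $$ (i, j)"
    using ij W X Y by (simp add: mat_adjoint_eq del: index_mult_mat(1))
  finally show "?L $$ (i, j) = ?R $$ (i, j)" .
qed (use X Y W in \<open>auto simp: mat_adjoint_eq\<close>)

section \<open>Products of block rows\<close>

lemma hcat_carrier: "hcat n Ms \<in> carrier_mat n (length (concat (map cols Ms)))"
  by (simp add: hcat_def)

lemma length_concat_cols:
  assumes "\<And>M. M \<in> set Ms \<Longrightarrow> M \<in> carrier_mat n m"
  shows "length (concat (map cols Ms)) = length Ms * m"
  using assms by (induction Ms) auto

text \<open>
  Multiplying a block row by a block column adds up the products of the corresponding blocks; this
  is the last summand split off. Only the total numbers of columns before the last blocks have to
  agree, so the lemma serves both for $Z Z^*$ and for the product with the scaled identity blocks.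
\<close>

lemma hcat_snoc_mult_transpose:
  fixes M N :: "'a :: comm_semiring_0 mat"
  assumes len: "length (concat (map cols Ms)) = length (concat (map cols Ns))"
    and M: "M \<in> carrier_mat n m" and N: "N \<in> carrier_mat n' m"
  shows "hcat n (Ms @ [M]) * (hcat n' (Ns @ [N]))\<^sup>T = hcat n Ms * (hcat n' Ns)\<^sup>T + M * N\<^sup>T"
    (is "?L = ?R")
proof (rule eq_matI)
  fix i j assume "i < dim_row ?R" and "j < dim_col ?R"
  then have i: "i < n" and j: "j < n'"
    using M N by auto
  define us where "us = concat (map cols Ms)"
  define vs where "vs = concat (map cols Ns)"
  have uv: "length us = length vs"
    using len by (simp add: us_def vs_def)
  have split: "sum f {0..<length vs + m} = sum f {0..<length vs} + (\<Sum>k<m. f (length vs + k))"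
    for f :: "nat \<Rightarrow> 'a"
    using sum.atLeastLessThan_concat[of 0 "length vs" "length vs + m" f]
      sum.shift_bounds_nat_ivl[of f 0 "length vs" m]
    by (simp add: lessThan_atLeast0 add.commute)
  have "?L $$ (i, j) = (\<Sum>k = 0..<length vs + m. ((us @ cols M) ! k $ i) * ((vs @ cols N) ! k $ j))"
    using i j M N uv
    by (auto simp: hcat_def us_def vs_def scalar_prod_def mat_of_cols_def intro!: sum.cong)
  also have "\<dots> = (\<Sum>k = 0..<length vs. (us ! k $ i) * (vs ! k $ j))
      + (\<Sum>k<m. M $$ (i, k) * N $$ (j, k))"
    unfolding split using i j M N uv by (auto simp: nth_append intro!: arg_cong2[where f = "(+)"] sum.cong)
  also have "\<dots> = ?R $$ (i, j)"
    using i j M N uv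
    by (auto simp: hcat_def us_def[symmetric] vs_def[symmetric] scalar_prod_def mat_of_cols_def
        lessThan_atLeast0 intro!: arg_cong2[where f = "(+)"] sum.cong)
  finally show "?L $$ (i, j) = ?R $$ (i, j)" .
qed (use M N in \<open>auto simp: hcat_def\<close>)

lemma mat_adjoint_hcat:
  assumes "\<And>M. M \<in> set Ms \<Longrightarrow> dim_row M = n"
  shows "mat_adjoint (hcat n Ms) = (hcat n (map conj_mat Ms))\<^sup>T"
proof -
  have cols: "concat (map cols (map conj_mat Ms)) = map (map_vec cnj) (concat (map cols Ms))"
    by (induction Ms) (auto simp: cols_def intro!: eq_vecI)
  have "set (concat (map cols Ms)) \<subseteq> carrier_vec n"
    using assms by (auto simp: cols_def intro!: carrier_vecI)
  then show ?thesis
    unfolding mat_adjoint_eq hcat_def cols by simp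
qed

section \<open>Stability and conjugate-closed shifts\<close>

text \<open>
  A kernel vector $v$ of $A - s E$ satisfies $A v = s E v$, hence $E^{-1} A v = s v$.
\<close>

lemma det_shifted_nonzero:
  fixes A E :: "real mat"
  assumes A: "A \<in> carrier_mat n n" and E: "E \<in> carrier_mat n n" and det: "det E \<noteq> 0"
    and not_ev: "\<not> eigenvalue (cmat (mat_inv E * A)) s"
  shows "det (cmat A - s \<cdot>\<^sub>m cmat E) \<noteq> 0"
proof
  note inv = mat_inv_eqs[OF E det]
  have cA: "cmat A \<in> carrier_mat n n" and cE: "cmat E \<in> carrier_mat n n"
    and cG: "cmat (mat_inv E) \<in> carrier_mat n n"
    using A E inv by auto
  have GE: "cmat (mat_inv E) * cmat E = 1\<^sub>m n"
    using of_real_hom.mat_hom_mult[OF inv(1) E] inv(3) of_real_hom.mat_hom_one by metis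
  assume "det (cmat A - s \<cdot>\<^sub>m cmat E) = 0"
  then obtain v where v: "v \<in> carrier_vec n" "v \<noteq> 0\<^sub>v n" and ker: "(cmat A - s \<cdot>\<^sub>m cmat E) *\<^sub>v v = 0\<^sub>v n"
    using det_0_iff_vec_prod_zero_field[of "cmat A - s \<cdot>\<^sub>m cmat E" n]
      minus_carrier_mat[OF smult_carrier_mat[OF cE], of "cmat A" s] by blast
  have Ev: "cmat E *\<^sub>v v \<in> carrier_vec n" and Av: "cmat A *\<^sub>v v \<in> carrier_vec n"
    using cE cA v by auto
  have sE: "(s \<cdot>\<^sub>m cmat E) *\<^sub>v v = s \<cdot>\<^sub>v (cmat E *\<^sub>v v)"
    using cE v by (intro eq_vecI) auto
  have "cmat A *\<^sub>v v - s \<cdot>\<^sub>v (cmat E *\<^sub>v v) = 0\<^sub>v n"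
    using ker minus_mult_distrib_mat_vec[OF cA smult_carrier_mat[OF cE] v(1)] sE by simp
  then have AvE: "cmat A *\<^sub>v v = s \<cdot>\<^sub>v (cmat E *\<^sub>v v)"
    using Av Ev A E by (intro eq_vecI) (auto dest!: arg_cong[where f = "\<lambda>u. u $ _"] simp: vec_eq_iff)
  have "cmat (mat_inv E * A) *\<^sub>v v = cmat (mat_inv E) *\<^sub>v (cmat A *\<^sub>v v)"
    unfolding of_real_hom.mat_hom_mult[OF inv(1) A] by (rule assoc_mult_mat_vec[OF cG cA v(1)])
  also have "\<dots> = s \<cdot>\<^sub>v (cmat (mat_inv E) *\<^sub>v (cmat E *\<^sub>v v))"
    unfolding AvE using mult_mat_vec[OF cG Ev] .
  also have "\<dots> = s \<cdot>\<^sub>v v"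
    unfolding assoc_mult_mat_vec[OF cG cE v(1), symmetric] GE using v by simp
  finally have "eigenvalue (cmat (mat_inv E * A)) s"
    using v inv(1) unfolding eigenvalue_def eigenvector_def by auto
  with not_ev show False ..
qed

lemma mset_map_cnj:
  assumes "closed_under_cnj \<sigma>"
  shows "mset (map cnj \<sigma>) = mset \<sigma>"
proof (rule multiset_eqI)
  fix s
  have "count_list (map cnj \<sigma>) s = count_list \<sigma> (cnj s)"
    by (induction \<sigma>) auto
  moreover have "count_list \<sigma> (cnj s) = count_list \<sigma> s"
  proof (cases "s \<in> \<real> \<or> s \<in> set \<sigma> \<or> cnj s \<in> set \<sigma>")
    case True
    then consider "s \<in> \<real>" | "s \<notin> \<real>" "s \<in> set \<sigma>" | "cnj s \<notin> \<real>" "cnj s \<in> set \<sigma>"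
      using Reals_cnj_iff by (metis complex_cnj_cnj)
    then show ?thesis
      using assms unfolding closed_under_cnj_def by cases (auto simp: Reals_cnj_iff)
  qed (simp add: count_list_0_iff)
  ultimately show "count (mset (map cnj \<sigma>)) s = count (mset \<sigma>) s"
    by (simp only: count_mset)
qed

section \<open>One shift applied to the residual factor\<close>

text \<open>
  The map $W \<mapsto> (A + cnj(s) E) (A - s E)^{-1} W$, a Cayley transform. In the form chosen here it is
  visibly the old residual factor plus a multiple of $E$ times a resolvent applied to it, which is
  the shape in which the ADI blocks enter.
\<close>

definition resid_step :: "complex mat \<Rightarrow> complex mat \<Rightarrow> complex \<Rightarrow> complex mat \<Rightarrow> complex mat" where
  "resid_step A E s W =
    W + complex_of_real (2 * Re s) \<cdot>\<^sub>m (E * (mat_inv (A - s \<cdot>\<^sub>m E) * W))"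

lemma resid_step_conj:
  assumes A: "A \<in> carrier_mat n n" and E: "E \<in> carrier_mat n n" and W: "W \<in> carrier_mat n m"
    and det: "det (A - s \<cdot>\<^sub>m E) \<noteq> 0"
    and real: "conj_mat A = A" "conj_mat E = E"
  shows "conj_mat (resid_step A E s W) = resid_step A E (cnj s) (conj_mat W)"
proof -
  have F: "A - s \<cdot>\<^sub>m E \<in> carrier_mat n n"
    using A E by auto
  note C = mat_inv_eqs(1)[OF F det]
  have "conj_mat (A - s \<cdot>\<^sub>m E) = conj_mat A - cnj s \<cdot>\<^sub>m conj_mat E"
    using A E by (intro eq_matI) auto
  then have inv: "conj_mat (mat_inv (A - s \<cdot>\<^sub>m E)) = mat_inv (A - cnj s \<cdot>\<^sub>m E)"
    using mat_inv_conj_mat[OF F det] real by simp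
  have CW: "mat_inv (A - s \<cdot>\<^sub>m E) * W \<in> carrier_mat n m"
    using C W by simp
  have "conj_mat (resid_step A E s W) = conj_mat W
      + complex_of_real (2 * Re s) \<cdot>\<^sub>m conj_mat (E * (mat_inv (A - s \<cdot>\<^sub>m E) * W))"
    unfolding resid_step_def using E CW W by (intro eq_matI) (auto simp del: index_mult_mat(1))
  then show ?thesis
    unfolding conj_mat_mult[OF E CW] conj_mat_mult[OF C W] inv real
    by (simp add: resid_step_def)
qed

locale adi =
  fixes A E B :: "complex mat" and n m :: nat and \<sigma> :: "complex list"
  assumes A: "A \<in> carrier_mat n n" and E: "E \<in> carrier_mat n n" and B: "B \<in> carrier_mat n m"
    and det_shifted: "s \<in> set \<sigma> \<Longrightarrow> det (A - s \<cdot>\<^sub>m E) \<noteq> 0"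
    and Re_pos: "s \<in> set \<sigma> \<Longrightarrow> Re s > 0"
begin

abbreviation shift_inv :: "complex \<Rightarrow> complex mat" where
  "shift_inv s \<equiv> mat_inv (A - s \<cdot>\<^sub>m E)"

lemma shifted: "A - s \<cdot>\<^sub>m E \<in> carrier_mat n n"
  using A E by auto

lemmas shift_inv = mat_inv_eqs[OF shifted det_shifted]

text \<open>
  From $(t - s) E = (A - s E) - (A - t E)$, multiplied by the two inverses from both sides.
\<close>

lemma resolvent_identity:
  assumes s: "s \<in> set \<sigma>" and t: "t \<in> set \<sigma>"
  shows "(t - s) \<cdot>\<^sub>m (shift_inv s * (E * shift_inv t)) = shift_inv t - shift_inv s"
proof -
  note Cs = shift_inv[OF s] and Ct = shift_inv[OF t]
  have "(t - s) \<cdot>\<^sub>m E = (A - s \<cdot>\<^sub>m E) - (A - t \<cdot>\<^sub>m E)"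
    using A E by (intro eq_matI) (auto simp: algebra_simps)
  then have "(t - s) \<cdot>\<^sub>m (E * shift_inv t) = ((A - s \<cdot>\<^sub>m E) - (A - t \<cdot>\<^sub>m E)) * shift_inv t"
    using mult_smult_assoc_mat[OF E Ct(1)] by metis
  also have "\<dots> = (A - s \<cdot>\<^sub>m E) * shift_inv t - 1\<^sub>m n"
    using minus_mult_distrib_mat[OF shifted shifted Ct(1)] Ct(2) by simp
  finally have eq: "(t - s) \<cdot>\<^sub>m (E * shift_inv t) = (A - s \<cdot>\<^sub>m E) * shift_inv t - 1\<^sub>m n" .
  have "(t - s) \<cdot>\<^sub>m (shift_inv s * (E * shift_inv t)) = shift_inv s * ((t - s) \<cdot>\<^sub>m (E * shift_inv t))"
    using mult_smult_distrib[OF Cs(1) mult_carrier_mat[OF E Ct(1)]] by simp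
  also have "\<dots> = shift_inv s * ((A - s \<cdot>\<^sub>m E) * shift_inv t) - shift_inv s * 1\<^sub>m n"
    unfolding eq by (rule mult_minus_distrib_mat[OF Cs(1) mult_carrier_mat[OF shifted Ct(1)]]) simp
  also have "\<dots> = shift_inv t - shift_inv s"
    using Cs Ct assoc_mult_mat[OF Cs(1) shifted Ct(1)] by (metis left_mult_one_mat right_mult_one_mat)
  finally show ?thesis .
qed

text \<open>
  For distinct shifts both sides are the same multiple of the difference of the two inverses in the
  resolvent identity, which is antisymmetric in the shifts.
\<close>

lemma resolvents_commute:
  assumes s: "s \<in> set \<sigma>" and t: "t \<in> set \<sigma>"
  shows "shift_inv s * (E * shift_inv t) = shift_inv t * (E * shift_inv s)" (is "?L = ?R")
proof (cases "s = t")
  case False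
  note Cs = shift_inv(1)[OF s] and Ct = shift_inv(1)[OF t]
  show ?thesis
  proof (rule eq_matI)
    fix i j assume "i < dim_row ?R" and "j < dim_col ?R"
    then have ij: "i < n" "j < n"
      using Cs Ct by auto
    have "((t - s) \<cdot>\<^sub>m ?L) $$ (i, j) = - (((s - t) \<cdot>\<^sub>m ?R) $$ (i, j))"
      unfolding resolvent_identity[OF s t] resolvent_identity[OF t s] using ij Cs Ct by simp
    then have "(t - s) * ?L $$ (i, j) = (t - s) * ?R $$ (i, j)"
      using ij Cs Ct E by (simp add: algebra_simps del: index_mult_mat(1))
    then show "?L $$ (i, j) = ?R $$ (i, j)"
      using False by simp
  qed (use Cs Ct in auto)
qed simp

lemma resid_step_carrier:
  assumes "W \<in> carrier_mat n m" and "s \<in> set \<sigma>"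
  shows "resid_step A E s W \<in> carrier_mat n m"
  using assms shift_inv(1) E by (auto simp: resid_step_def)

lemma shift_inv_resid_step:
  assumes W: "W \<in> carrier_mat n m" and s: "s \<in> set \<sigma>" and t: "t \<in> set \<sigma>"
  shows "shift_inv t * resid_step A E s W = shift_inv t * W
    + complex_of_real (2 * Re s) \<cdot>\<^sub>m (shift_inv t * (E * shift_inv s) * W)"
proof -
  note Cs = shift_inv(1)[OF s] and Ct = shift_inv(1)[OF t]
  have ECW: "E * (shift_inv s * W) \<in> carrier_mat n m"
    using Cs E W by auto
  have "shift_inv t * (E * shift_inv s) * W = shift_inv t * (E * (shift_inv s * W))"
    using assoc_mult_mat[OF Ct mult_carrier_mat[OF E Cs] W] assoc_mult_mat[OF E Cs W] by simp
  then show ?thesis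
    unfolding resid_step_def
    using mult_add_distrib_mat[OF Ct W smult_carrier_mat[OF ECW]] mult_smult_distrib[OF Ct ECW]
    by simp
qed

text \<open>
  Both orders give $W$ plus the two first-order terms plus a mixed term $E C_s E C_t W$ (with
  $C_s$, $C_t$ the inverses of the shifted matrices), and the mixed term is symmetric because the
  resolvents commute.
\<close>

lemma resid_step_commute:
  assumes W: "W \<in> carrier_mat n m" and s: "s \<in> set \<sigma>" and t: "t \<in> set \<sigma>"
  shows "resid_step A E s (resid_step A E t W) = resid_step A E t (resid_step A E s W)"
proof -
  note Cs = shift_inv(1)[OF s] and Ct = shift_inv(1)[OF t]
  define a where "a = complex_of_real (2 * Re s)"
  define b where "b = complex_of_real (2 * Re t)"
  define D where "D = shift_inv s * (E * shift_inv t)"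
  have D: "D \<in> carrier_mat n n"
    using Cs Ct E by (auto simp: D_def)
  have dist: "E * (C * W + c \<cdot>\<^sub>m (D * W)) = E * (C * W) + c \<cdot>\<^sub>m (E * (D * W))"
    if "C \<in> carrier_mat n n" for C c
    using mult_add_distrib_mat[OF E mult_carrier_mat[OF that W] smult_carrier_mat[OF mult_carrier_mat[OF D W]]]
      mult_smult_distrib[OF E mult_carrier_mat[OF D W]] by simp
  have L: "resid_step A E s (resid_step A E t W) = (W + b \<cdot>\<^sub>m (E * (shift_inv t * W)))
      + a \<cdot>\<^sub>m (E * (shift_inv s * W) + b \<cdot>\<^sub>m (E * (D * W)))"
    unfolding resid_step_def[of A E s] shift_inv_resid_step[OF W t s] D_def[symmetric] dist[OF Cs]
      a_def[symmetric] b_def[symmetric]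
    by (simp add: resid_step_def b_def)
  have R: "resid_step A E t (resid_step A E s W) = (W + a \<cdot>\<^sub>m (E * (shift_inv s * W)))
      + b \<cdot>\<^sub>m (E * (shift_inv t * W) + a \<cdot>\<^sub>m (E * (D * W)))"
    unfolding resid_step_def[of A E t] shift_inv_resid_step[OF W s t] resolvents_commute[OF t s]
      D_def[symmetric] dist[OF Ct] a_def[symmetric] b_def[symmetric]
    by (simp add: resid_step_def a_def)
  show ?thesis
    unfolding L R using E W Cs Ct D
    by (intro eq_matI) (auto simp: algebra_simps simp del: index_mult_mat(1))
qed

text \<open>
  The matrix $W_i$ of the introduction. Indices of shifts and blocks start at 0, so the block with
  index $i$ is built from $W_i$ and leads to $W_{i+1}$.
\<close>

abbreviation resid_factor :: "nat \<Rightarrow> complex mat" where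
  "resid_factor i \<equiv> fold (resid_step A E) (take i \<sigma>) B"

lemma resid_factor_Suc:
  "i < length \<sigma> \<Longrightarrow> resid_factor (Suc i) = resid_step A E (\<sigma> ! i) (resid_factor i)"
  by (simp add: take_Suc_conv_app_nth)

lemma resid_factor_carrier: "i \<le> length \<sigma> \<Longrightarrow> resid_factor i \<in> carrier_mat n m"
proof (induction i)
  case (Suc i)
  then show ?case
    using resid_step_carrier resid_factor_Suc[of i] by simp
qed (use B in simp)

section \<open>The ADI basis in terms of the residual factors\<close>

abbreviation \<alpha> :: "nat \<Rightarrow> complex" where
  "\<alpha> i \<equiv> complex_of_real (sqrt (2 * Re (\<sigma> ! i)))"

lemma \<alpha>_square: "i < length \<sigma> \<Longrightarrow> \<alpha> i * \<alpha> i = complex_of_real (2 * Re (\<sigma> ! i))"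
  using Re_pos[of "\<sigma> ! i"] by (simp flip: of_real_mult)

text \<open>
  The recursion for the blocks passes from $Z_i$ to $Z_{i+1}$ directly. This closed form links each
  block to the residual factor of the preceding shifts instead. With $C_s = (A - s E)^{-1}$,
  $s = \<sigma>_i$ and $t = \<sigma>_{i+1}$, the resolvent identity turns
  $(I + (t + cnj(s)) C_t E) C_s$ into $C_t (I + 2 Re(s) E C_s)$, and the second factor is
  the step from one residual factor to the next. The scalars telescope.
\<close>

lemma adi_block_eq:
  "i < length \<sigma> \<Longrightarrow> adi_block A E B \<sigma> i = \<alpha> i \<cdot>\<^sub>m (shift_inv (\<sigma> ! i) * resid_factor i)"
proof (induction i)
  case (Suc i)
  define s t W where "s = \<sigma> ! i" and "t = \<sigma> ! Suc i" and "W = resid_factor i"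
  have s: "s \<in> set \<sigma>" and t: "t \<in> set \<sigma>"
    using Suc.prems by (auto simp: s_def t_def)
  have W: "W \<in> carrier_mat n m"
    using resid_factor_carrier Suc.prems by (simp add: W_def)
  note Cs = shift_inv(1)[OF s] and Ct = shift_inv(1)[OF t]
  define D where "D = shift_inv t * (E * shift_inv s)"
  have D: "D \<in> carrier_mat n n"
    using Cs Ct E by (auto simp: D_def)
  have "complex_of_real (sqrt (Re t / Re s)) * \<alpha> i = complex_of_real (sqrt (Re t / Re s * (2 * Re s)))"
    by (simp only: s_def real_sqrt_mult of_real_mult)
  also have "\<dots> = \<alpha> (Suc i)"
    using Re_pos[OF s] by (simp add: t_def mult.commute)
  finally have scal: "complex_of_real (sqrt (Re t / Re s)) * \<alpha> i = \<alpha> (Suc i)" .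
  have TE: "shift_inv t * E * shift_inv s = D"
    using assoc_mult_mat[OF Ct E Cs] by (simp add: D_def)
  have TEc: "(t + cnj s) \<cdot>\<^sub>m (shift_inv t * E) \<in> carrier_mat n n"
    using Ct E by auto
  have *: "(1\<^sub>m n + (t + cnj s) \<cdot>\<^sub>m (shift_inv t * E)) * shift_inv s = shift_inv s + (t + cnj s) \<cdot>\<^sub>m D"
    using add_mult_distrib_mat[OF one_carrier_mat TEc Cs] mult_smult_assoc_mat[OF mult_carrier_mat[OF Ct E] Cs]
      TE Cs by simp
  \<comment> \<open>The resolvent identity replaces the leading inverse at the old shift by the one at the new
    shift, at the cost of changing the coefficient of the mixed term.\<close>
  also have "\<dots> = shift_inv t + complex_of_real (2 * Re s) \<cdot>\<^sub>m D"
  proof (rule eq_matI)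
    fix i j assume "i < dim_row (shift_inv t + complex_of_real (2 * Re s) \<cdot>\<^sub>m D)"
      and "j < dim_col (shift_inv t + complex_of_real (2 * Re s) \<cdot>\<^sub>m D)"
    then have ij: "i < n" "j < n"
      using D by auto
    have "((s - t) \<cdot>\<^sub>m D) $$ (i, j) = (shift_inv s - shift_inv t) $$ (i, j)"
      unfolding D_def resolvent_identity[OF t s] ..
    then have "(s - t) * D $$ (i, j) = shift_inv s $$ (i, j) - shift_inv t $$ (i, j)"
      using ij Cs Ct D by simp
    then have "shift_inv s $$ (i, j) + (t + cnj s) * D $$ (i, j)
        = shift_inv t $$ (i, j) + (s + cnj s) * D $$ (i, j)"
      by (simp add: algebra_simps)
    then show "(shift_inv s + (t + cnj s) \<cdot>\<^sub>m D) $$ (i, j)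
        = (shift_inv t + complex_of_real (2 * Re s) \<cdot>\<^sub>m D) $$ (i, j)"
      using ij Cs Ct D by (simp add: complex_add_cnj)
  qed (use Cs Ct D in auto)
  finally have **: "(1\<^sub>m n + (t + cnj s) \<cdot>\<^sub>m (shift_inv t * E)) * shift_inv s
      = shift_inv t + complex_of_real (2 * Re s) \<cdot>\<^sub>m D" .
  have Fc: "1\<^sub>m n + (t + cnj s) \<cdot>\<^sub>m (shift_inv t * E) \<in> carrier_mat n n"
    using TEc by simp
  have "(1\<^sub>m n + (t + cnj s) \<cdot>\<^sub>m (shift_inv t * E)) * (shift_inv s * W)
      = (shift_inv t + complex_of_real (2 * Re s) \<cdot>\<^sub>m D) * W"
    using assoc_mult_mat[OF Fc Cs W] ** by simp
  also have "\<dots> = shift_inv t * W + complex_of_real (2 * Re s) \<cdot>\<^sub>m (D * W)"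
    using add_mult_distrib_mat[OF Ct smult_carrier_mat[OF D] W] mult_smult_assoc_mat[OF D W] by simp
  also have "\<dots> = shift_inv t * resid_factor (Suc i)"
    using shift_inv_resid_step[OF W s t] resid_factor_Suc[of i] Suc.prems
    by (simp add: D_def W_def s_def)
  finally have main: "(1\<^sub>m n + (t + cnj s) \<cdot>\<^sub>m (shift_inv t * E)) * (shift_inv s * W)
      = shift_inv t * resid_factor (Suc i)" .
  have blk: "adi_block A E B \<sigma> i = \<alpha> i \<cdot>\<^sub>m (shift_inv s * W)"
    using Suc by (simp add: s_def W_def)
  have "adi_block A E B \<sigma> (Suc i) = complex_of_real (sqrt (Re t / Re s)) \<cdot>\<^sub>m
      ((1\<^sub>m n + (t + cnj s) \<cdot>\<^sub>m (shift_inv t * E)) * (\<alpha> i \<cdot>\<^sub>m (shift_inv s * W)))"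
    unfolding adi_block.simps blk using A by (simp add: s_def t_def)
  also have "\<dots> = complex_of_real (sqrt (Re t / Re s)) \<cdot>\<^sub>m (\<alpha> i \<cdot>\<^sub>m (shift_inv t * resid_factor (Suc i)))"
    using mult_smult_distrib[OF Fc mult_carrier_mat[OF Cs W]] main by simp
  also have "\<dots> = \<alpha> (Suc i) \<cdot>\<^sub>m (shift_inv t * resid_factor (Suc i))"
    unfolding scal[symmetric] by (intro eq_matI) (auto simp del: index_mult_mat(1))
  finally show ?case
    by (simp add: t_def)
qed simp

lemma adi_block_carrier: "i < length \<sigma> \<Longrightarrow> adi_block A E B \<sigma> i \<in> carrier_mat n m"
  using shift_inv(1)[of "\<sigma> ! i"] resid_factor_carrier[of i] by (auto simp: adi_block_eq)

abbreviation basis :: "nat \<Rightarrow> complex mat" where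
  "basis i \<equiv> hcat n (map (adi_block A E B \<sigma>) [0..<i])"

lemma length_basis_cols:
  "i \<le> length \<sigma> \<Longrightarrow> length (concat (map cols (map (adi_block A E B \<sigma>) [0..<i]))) = i * m"
  by (subst length_concat_cols[where n = n and m = m]) (auto simp: adi_block_carrier)

lemma basis_carrier: "i \<le> length \<sigma> \<Longrightarrow> basis i \<in> carrier_mat n (i * m)"
  using hcat_carrier length_basis_cols by metis

lemma L_ADI_carrier: "L_ADI m ss \<in> carrier_mat m (length ss * m)"
  using hcat_carrier length_concat_cols[of "map (\<lambda>s. complex_of_real (sqrt (2 * Re s)) \<cdot>\<^sub>m 1\<^sub>m m) ss" m m]
  unfolding L_ADI_def by fastforce

lemma basis_mult_L_ADI_Suc:
  assumes i: "i < length \<sigma>"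
  shows "basis (Suc i) * (L_ADI m (take (Suc i) \<sigma>))\<^sup>T
    = basis i * (L_ADI m (take i \<sigma>))\<^sup>T + \<alpha> i \<cdot>\<^sub>m adi_block A E B \<sigma> i"
proof -
  let ?l = "\<lambda>s. complex_of_real (sqrt (2 * Re s)) \<cdot>\<^sub>m 1\<^sub>m m"
  note blk = adi_block_carrier[OF i]
  have len: "length (concat (map cols (map (adi_block A E B \<sigma>) [0..<i])))
      = length (concat (map cols (map ?l (take i \<sigma>))))"
    using i by (subst length_basis_cols, simp, subst length_concat_cols[where n = m and m = m]) auto
  have "adi_block A E B \<sigma> i * (\<alpha> i \<cdot>\<^sub>m 1\<^sub>m m)\<^sup>T = adi_block A E B \<sigma> i * (\<alpha> i \<cdot>\<^sub>m 1\<^sub>m m)"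
    by (rule arg_cong[where f = "(*) _"]) (intro eq_matI; auto)
  also have "\<dots> = \<alpha> i \<cdot>\<^sub>m adi_block A E B \<sigma> i"
    using mult_smult_distrib[OF blk one_carrier_mat] blk by simp
  finally show ?thesis
    using hcat_snoc_mult_transpose[OF len blk, where N = "?l (\<sigma> ! i)" and n' = m] i
    by (simp add: L_ADI_def take_Suc_conv_app_nth)
qed

lemma resid_factor_Suc_block:
  assumes i: "i < length \<sigma>"
  shows "resid_factor (Suc i) = resid_factor i + \<alpha> i \<cdot>\<^sub>m (E * adi_block A E B \<sigma> i)"
proof -
  have s: "\<sigma> ! i \<in> set \<sigma>"
    using i by simp
  have W: "resid_factor i \<in> carrier_mat n m"
    using resid_factor_carrier i by simp
  note CW = mult_carrier_mat[OF shift_inv(1)[OF s] W]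
  have "\<alpha> i \<cdot>\<^sub>m (E * adi_block A E B \<sigma> i)
      = complex_of_real (2 * Re (\<sigma> ! i)) \<cdot>\<^sub>m (E * (shift_inv (\<sigma> ! i) * resid_factor i))"
    unfolding adi_block_eq[OF i] mult_smult_distrib[OF E CW] \<alpha>_square[OF i, symmetric]
    by (intro eq_matI) (auto simp del: index_mult_mat(1))
  then show ?thesis
    by (simp add: resid_factor_Suc[OF i] resid_step_def)
qed

text \<open>
  Each shift adds $\<alpha>_i E Z_i$ to the residual factor, and $Z L^T$ is the sum of the $\<alpha>_i Z_i$.
\<close>

lemma resid_factor_eq:
  "i \<le> length \<sigma> \<Longrightarrow> resid_factor i = B + E * (basis i * (L_ADI m (take i \<sigma>))\<^sup>T)"
proof (induction i)
  case 0
  have "basis 0 * (L_ADI m (take 0 \<sigma>))\<^sup>T = 0\<^sub>m n m"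
    by (intro eq_matI) (auto simp: hcat_def L_ADI_def scalar_prod_def)
  then show ?case
    using B E by simp
next
  case (Suc i)
  then have i: "i < length \<sigma>"
    by simp
  note blk = adi_block_carrier[OF i]
  let ?M = "basis i * (L_ADI m (take i \<sigma>))\<^sup>T"
  have M: "?M \<in> carrier_mat n m"
    using basis_carrier[of i] L_ADI_carrier[of "take i \<sigma>"] i by auto
  have "resid_factor (Suc i) = (B + E * ?M) + E * (\<alpha> i \<cdot>\<^sub>m adi_block A E B \<sigma> i)"
    unfolding resid_factor_Suc_block[OF i] mult_smult_distrib[OF E blk] using Suc i by simp
  also have "\<dots> = B + E * (?M + \<alpha> i \<cdot>\<^sub>m adi_block A E B \<sigma> i)"
    using mult_add_distrib_mat[OF E M smult_carrier_mat[OF blk]] B E M blk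
    by (simp add: assoc_add_mat[of _ n m])
  finally show ?case
    by (simp only: basis_mult_L_ADI_Suc[OF i])
qed

lemma A_mult_adi_block:
  assumes i: "i < length \<sigma>"
  shows "A * adi_block A E B \<sigma> i = (\<sigma> ! i) \<cdot>\<^sub>m (E * adi_block A E B \<sigma> i) + \<alpha> i \<cdot>\<^sub>m resid_factor i"
proof -
  let ?s = "\<sigma> ! i" and ?Z = "adi_block A E B \<sigma> i"
  have s: "?s \<in> set \<sigma>"
    using i by simp
  note C = shift_inv[OF s] and Z = adi_block_carrier[OF i]
  have W: "resid_factor i \<in> carrier_mat n m"
    using resid_factor_carrier i by simp
  have "A * ?Z - ?s \<cdot>\<^sub>m (E * ?Z) = (A - ?s \<cdot>\<^sub>m E) * ?Z"
    using minus_mult_distrib_mat[OF A smult_carrier_mat[OF E] Z] mult_smult_assoc_mat[OF E Z] by simp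
  also have "\<dots> = \<alpha> i \<cdot>\<^sub>m ((A - ?s \<cdot>\<^sub>m E) * (shift_inv ?s * resid_factor i))"
    unfolding adi_block_eq[OF i] by (rule mult_smult_distrib[OF shifted mult_carrier_mat[OF C(1) W]])
  also have "\<dots> = \<alpha> i \<cdot>\<^sub>m resid_factor i"
    using assoc_mult_mat[OF shifted[of ?s] C(1) W] C(2) W by simp
  finally have eq: "A * ?Z - ?s \<cdot>\<^sub>m (E * ?Z) = \<alpha> i \<cdot>\<^sub>m resid_factor i" .
  show ?thesis
    unfolding eq[symmetric] using A E Z by (intro eq_matI) (auto simp del: index_mult_mat(1))
qed

section \<open>The residual as a Gram matrix\<close>

text \<open>
  Induction on the number of shifts: a new block $Z_i$ changes the left-hand side by
  $A Z_i (E Z_i)^* + E Z_i (A Z_i)^*$, and by \<open>gram_update\<close> the Gram matrix of the residual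
  factor changes by the same amount. With no shifts, both sides are $B B^*$.
\<close>

lemma residual_eq:
  "i \<le> length \<sigma> \<Longrightarrow>
    A * (basis i * mat_adjoint (basis i)) * mat_adjoint E + E * (basis i * mat_adjoint (basis i)) * mat_adjoint A
      + B * mat_adjoint B
    = resid_factor i * mat_adjoint (resid_factor i)"
proof (induction i)
  case 0
  have "basis 0 * mat_adjoint (basis 0) = 0\<^sub>m n n"
    by (intro eq_matI) (auto simp: hcat_def mat_adjoint_eq scalar_prod_def)
  then show ?case
    using A B E mat_adjoint_carrier[OF A] mat_adjoint_carrier[OF B] mat_adjoint_carrier[OF E] by simp
next
  case (Suc i)
  then have i: "i < length \<sigma>"
    by simp
  let ?Z = "adi_block A E B \<sigma> i" and ?P = "basis i * mat_adjoint (basis i)"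
  note Z = adi_block_carrier[OF i] and A' = mat_adjoint_carrier[OF A] and E' = mat_adjoint_carrier[OF E]
  have W: "resid_factor i \<in> carrier_mat n m"
    using resid_factor_carrier i by simp
  have P: "?P \<in> carrier_mat n n"
    using basis_carrier[of i] i by (auto simp: mat_adjoint_eq)
  have Q: "?Z * mat_adjoint ?Z \<in> carrier_mat n n"
    using Z by (auto simp: mat_adjoint_eq)
  have adj: "mat_adjoint (basis k) = (hcat n (map conj_mat (map (adi_block A E B \<sigma>) [0..<k])))\<^sup>T"
    if "k \<le> length \<sigma>" for k
  proof (rule mat_adjoint_hcat)
    fix M assume "M \<in> set (map (adi_block A E B \<sigma>) [0..<k])"
    then obtain j where "j < k" and "M = adi_block A E B \<sigma> j"
      by auto
    then show "dim_row M = n"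
      using adi_block_carrier[of j] that by auto
  qed
  have len: "length (concat (map cols (map (adi_block A E B \<sigma>) [0..<i])))
      = length (concat (map cols (map conj_mat (map (adi_block A E B \<sigma>) [0..<i]))))"
    by (simp add: length_concat comp_def)
  have "conj_mat ?Z \<in> carrier_mat n m"
    using Z by simp
  from hcat_snoc_mult_transpose[OF len Z this]
  have snoc: "basis (Suc i) * mat_adjoint (basis (Suc i)) = ?P + ?Z * mat_adjoint ?Z"
    unfolding adj[OF Suc.prems] adj[OF less_imp_le[OF i]] mat_adjoint_eq[of ?Z]
    by simp
  have dist: "M * (?P + ?Z * mat_adjoint ?Z) * mat_adjoint N = M * ?P * mat_adjoint N + (M * ?Z) * mat_adjoint (N * ?Z)"
    if M: "M \<in> carrier_mat n n" and N: "N \<in> carrier_mat n n" for M N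
    using mult_add_distrib_mat[OF M P Q] sandwich_gram[OF M N Z]
      add_mult_distrib_mat[OF mult_carrier_mat[OF M P] mult_carrier_mat[OF M Q] mat_adjoint_carrier[OF N]]
    by simp
  let ?X = "A * ?Z" and ?Y = "E * ?Z"
  have X: "?X \<in> carrier_mat n m" and Y: "?Y \<in> carrier_mat n m"
    using A E Z by auto
  have "A * (?P + ?Z * mat_adjoint ?Z) * mat_adjoint E + E * (?P + ?Z * mat_adjoint ?Z) * mat_adjoint A
      + B * mat_adjoint B
    = (A * ?P * mat_adjoint E + E * ?P * mat_adjoint A + B * mat_adjoint B)
      + (?X * mat_adjoint ?Y + ?Y * mat_adjoint ?X)"
    unfolding dist[OF A E] dist[OF E A]
    using A E B X Y mat_adjoint_carrier[OF A] mat_adjoint_carrier[OF E] mat_adjoint_carrier[OF B]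
      mat_adjoint_carrier[OF X] mat_adjoint_carrier[OF Y]
    by (intro eq_matI) (auto simp: add_ac simp del: index_mult_mat(1))
  also have "\<dots> = resid_factor i * mat_adjoint (resid_factor i) + (?X * mat_adjoint ?Y + ?Y * mat_adjoint ?X)"
    using Suc i by simp
  also have "\<dots> = resid_factor (Suc i) * mat_adjoint (resid_factor (Suc i))"
    unfolding resid_factor_Suc_block[OF i]
    by (rule gram_update[OF X Y W A_mult_adi_block[OF i], symmetric])
      (use Re_pos[of "\<sigma> ! i"] i in simp)
  finally show ?case
    unfolding snoc .
qed

section \<open>Realness of the residual factor\<close>

text \<open>
  Conjugating a product of steps conjugates the shifts, because $A$, $E$ and $B$ are real. If the
  shifts are closed under conjugation, this merely permutes them, and the steps commute.
\<close>

lemma resid_factor_real: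
  assumes closed: "closed_under_cnj \<sigma>"
    and real: "conj_mat A = A" "conj_mat E = E" "conj_mat B = B"
  shows "conj_mat (fold (resid_step A E) \<sigma> B) = fold (resid_step A E) \<sigma> B"
proof -
  have "conj_mat (fold (resid_step A E) ss W) = fold (resid_step A E) (map cnj ss) (conj_mat W)"
    if "set ss \<subseteq> set \<sigma>" "W \<in> carrier_mat n m" for ss W
    using that
    by (induction ss arbitrary: W) (auto simp: resid_step_carrier resid_step_conj[OF A E _ det_shifted real(1,2)])
  then have "conj_mat (fold (resid_step A E) \<sigma> B) = fold (resid_step A E) (map cnj \<sigma>) B"
    using B real(3) by simp
  also have "\<dots> = fold (resid_step A E) \<sigma> B"
  proof (rule fold_permuted_eq[where P = "\<lambda>W. W \<in> carrier_mat n m"])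
    have "set (map cnj \<sigma>) = set \<sigma>"
      using mset_map_cnj[OF closed] by (metis set_mset_mset)
    then show "resid_step A E s W \<in> carrier_mat n m"
      if "s \<in> set (map cnj \<sigma>)" "W \<in> carrier_mat n m" for s W
      using that resid_step_carrier by simp
    show "resid_step A E s (resid_step A E t W) = resid_step A E t (resid_step A E s W)"
      if "s \<in> set (map cnj \<sigma>)" "t \<in> set (map cnj \<sigma>)" "W \<in> carrier_mat n m" for s t W
      using that resid_step_commute \<open>set (map cnj \<sigma>) = set \<sigma>\<close> by simp
  qed (use mset_map_cnj[OF closed] B in auto)
  finally show ?thesis .
qed

end

theorem theorem3p6:
  fixes A E B :: "real mat" and n m :: nat and \<sigma> :: "complex list"
    and Z P R B_perp :: "complex mat"
  assumes "A \<in> carrier_mat n n" and "E \<in> carrier_mat n n" and "det E \<noteq> 0"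
    and "B \<in> carrier_mat n m"
    and "\<And>\<mu>. eigenvalue (cmat (mat_inv E * A)) \<mu> \<Longrightarrow> Re \<mu> < 0"
    and "\<And>s. s \<in> set \<sigma> \<Longrightarrow> Re s > 0"
    and "closed_under_cnj \<sigma>"
    and "Z = adi_basis (cmat A) (cmat E) (cmat B) \<sigma>"
    and "P = Z * mat_adjoint Z"
    and "R = cmat A * P * (cmat E)\<^sup>T + cmat E * P * (cmat A)\<^sup>T + cmat B * (cmat B)\<^sup>T"
    and "B_perp = cmat B + cmat E * Z * (L_ADI m \<sigma>)\<^sup>T"
  shows "R = B_perp * B_perp\<^sup>T"
proof -
  have nonzero: "det (cmat A - s \<cdot>\<^sub>m cmat E) \<noteq> 0" if "s \<in> set \<sigma>" for s
    using det_shifted_nonzero[OF assms(1-3)] assms(5)[of s] assms(6)[OF that] by force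
  interpret adi "cmat A" "cmat E" "cmat B" n m \<sigma>
    using assms(1,2,4,6) nonzero by unfold_locales auto
  have Z_eq: "Z = basis (length \<sigma>)"
    using assms(1) by (simp add: assms(8) adi_basis_def)
  have Z: "Z \<in> carrier_mat n (length \<sigma> * m)"
    unfolding Z_eq by (rule basis_carrier) simp
  have L: "(L_ADI m \<sigma>)\<^sup>T \<in> carrier_mat (length \<sigma> * m) m"
    using L_ADI_carrier by simp
  have B_perp: "B_perp = resid_factor (length \<sigma>)"
    using resid_factor_eq[of "length \<sigma>"] assoc_mult_mat[OF E Z L] by (simp add: assms(11) Z_eq)
  have "conj_mat B_perp = B_perp"
    using resid_factor_real[OF assms(7) conj_mat_real conj_mat_real conj_mat_real] by (simp add: B_perp)
  then have "B_perp\<^sup>T = mat_adjoint B_perp"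
    by (simp add: mat_adjoint_eq)
  moreover have "R = B_perp * mat_adjoint B_perp"
    using residual_eq[of "length \<sigma>"]
    by (simp add: assms(9,10) B_perp Z_eq mat_adjoint_eq[of "cmat _"] conj_mat_real)
  ultimately show ?thesis
    by simp
qed

end
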